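(* Let $\eta$ be Lorentzian, $e\in\Omega^1_{nd}(\partial M,\mathcal V^\partial)$, and assume $g^\partial=e^*\eta$ is nondegenerate. Then $$0\longrightarrow\ker(\mathsf W_e^{(1,2)})\xrightarrow{[\cdot,e]}\Omega^2(\partial M,\mathcal V^\partial)\xrightarrow{\mathsf W_e^{(2,1)}}\Omega^3(\partial M,\textstyle\bigwedge^2\mathcal V^\partial)\longrightarrow0$$ is a short exact sequence.
   Context: $\partial M$ is a 3-manifold, $\mathcal V^\partial$ a rank-4 bundle with fibre Minkowski metric $\eta$, $\bigwedge^2\mathcal V^\partial\cong\mathfrak{so}(3,1)$ acting on $\mathcal V^\partial$ ($[v,e]$ is this action combined with the wedge of forms). $\Omega^1_{nd}(\partial M,\mathcal V^\partial)$: 1-forms injective at each point. $\mathsf W_e^{(p,k)}:\Omega^p(\partial M,\bigwedge^k\mathcal V^\partial)\to\Omega^{p+1}(\partial M,\bigwedge^{k+1}\mathcal V^\partial)$, $X\mapsto X\wedge e$. *)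

theory Defs
  imports Complex_Main
begin

text \<open>Fibrewise (pointwise) model.  At a point x of the 3-manifold we fix a basis
  dx^0,dx^1,dx^2 of the cotangent space and an orthonormal frame v_0,...,v_3 of the
  fibre of V with eta = diag(-1,1,1,1).  An element of Omega^p(dM, wedge^k V) at x is
  represented by its coefficients w.r.t. the basis dx^P (x) v_K, indexed by
  P subset {0,1,2} with card P = p and K subset {0,..,3} with card K = k
  (increasingly ordered wedge products).\<close>

type_synonym coeffs = "nat set \<Rightarrow> nat set \<Rightarrow> real"

definition forms :: "nat \<Rightarrow> nat \<Rightarrow> coeffs set" where
  "forms p k = {f. \<forall>P K. f P K \<noteq> 0 \<longrightarrow>
      P \<subseteq> {..<3} \<and> card P = p \<and> K \<subseteq> {..<4} \<and> card K = k}"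

definition eta :: "nat \<Rightarrow> nat \<Rightarrow> real" where
  "eta i j = (if i = j then (if i = 0 then -1 else 1) else 0)"

text \<open>Sign of (basis of S in increasing order) wedge a = sign * basis of insert a S.\<close>
definition ins_sign :: "nat set \<Rightarrow> nat \<Rightarrow> real" where
  "ins_sign S a = (-1) ^ card {b \<in> S. a < b}"

text \<open>A V-valued 1-form e = sum_a sum_i e a i dx^a (x) v_i.\<close>
definition nondeg_form :: "(nat \<Rightarrow> nat \<Rightarrow> real) \<Rightarrow> bool" where
  "nondeg_form e \<longleftrightarrow> (\<forall>u :: nat \<Rightarrow> real.
      (\<forall>i<4. (\<Sum>a<3. u a * e a i) = 0) \<longrightarrow> (\<forall>a<3. u a = 0))"

definition pullback_metric :: "(nat \<Rightarrow> nat \<Rightarrow> real) \<Rightarrow> nat \<Rightarrow> nat \<Rightarrow> real" where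
  "pullback_metric e a b = (\<Sum>i<4. \<Sum>j<4. e a i * eta i j * e b j)"

definition nondegenerate3 :: "(nat \<Rightarrow> nat \<Rightarrow> real) \<Rightarrow> bool" where
  "nondegenerate3 g \<longleftrightarrow> (\<forall>u :: nat \<Rightarrow> real.
      (\<forall>b<3. (\<Sum>a<3. u a * g a b) = 0) \<longrightarrow> (\<forall>a<3. u a = 0))"

text \<open>W_e : X \<mapsto> X wedge e, with (alpha (x) A) wedge (beta (x) B) = (alpha wedge beta) (x) (A wedge B).\<close>
definition wedge_e :: "(nat \<Rightarrow> nat \<Rightarrow> real) \<Rightarrow> coeffs \<Rightarrow> coeffs" where
  "wedge_e e X Q L =
     (if Q \<subseteq> {..<3} \<and> L \<subseteq> {..<4} then
        (\<Sum>a\<in>Q. \<Sum>i\<in>L. X (Q - {a}) (L - {i}) * e a i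
                         * ins_sign (Q - {a}) a * ins_sign (L - {i}) i)
      else 0)"

definition W :: "(nat \<Rightarrow> nat \<Rightarrow> real) \<Rightarrow> nat \<Rightarrow> nat \<Rightarrow> coeffs \<Rightarrow> coeffs" where
  "W e p k X = wedge_e e X"

text \<open>Action of wedge^2 V = so(3,1) on V: (v_i wedge v_j) . w = v_i eta(v_j,w) - v_j eta(v_i,w).
  act J k m = coefficient of v_m in (v_i wedge v_j) . v_k, where J = {i,j}, i < j.\<close>
definition act :: "nat set \<Rightarrow> nat \<Rightarrow> nat \<Rightarrow> real" where
  "act J k m = (let i = Min J; j = Max J in
      eta j k * (if m = i then 1 else 0) - eta i k * (if m = j then 1 else 0))"

text \<open>[v,e] for v in Omega^1(wedge^2 V): sum_{a,b} (v_a . e_b) dx^a wedge dx^b.\<close>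
definition bracket :: "coeffs \<Rightarrow> (nat \<Rightarrow> nat \<Rightarrow> real) \<Rightarrow> coeffs" where
  "bracket v e Q M =
     (if Q \<subseteq> {..<3} \<and> card Q = 2 \<and> M \<subseteq> {..<4} \<and> card M = 1 then
        (\<Sum>a\<in>Q. \<Sum>b\<in>Q - {a}. \<Sum>J\<in>{J. J \<subseteq> {..<4} \<and> card J = 2}. \<Sum>k<4.
            v {a} J * e b k * (if a < b then 1 else -1) * act J k (the_elem M))
      else 0)"

end

theory Submission
  imports Defs "HOL-Analysis.Determinants"
begin

text \<open>Everything is fibrewise linear algebra in an orthonormal frame. Let \<open>n\<close> be the vector
  \<open>\<eta>\<close>-dual to \<open>w \<mapsto> det(e\<^sub>0, e\<^sub>1, e\<^sub>2, w)\<close>; then \<open>det(e\<^sub>0, e\<^sub>1, e\<^sub>2, n) = - det g\<close>, so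
  \<open>e\<^sub>0, e\<^sub>1, e\<^sub>2, n\<close> is a basis of the fibre and Cramer's rule in this basis does all the work.
  A 1-form \<open>v = \<Sum>\<^sub>a dx\<^sup>a \<otimes> v\<^sub>a\<close> with values in \<open>\<And>\<^sup>2V\<close> satisfies \<open>v \<and> e = 0\<close> iff
  \<open>v\<^sub>a = \<Sum>\<^sub>c S\<^sub>a\<^sub>c e\<^sub>c\<^sub>+\<^sub>1 \<and> e\<^sub>c\<^sub>+\<^sub>2\<close> (indices mod 3) with \<open>S\<close> symmetric. For such \<open>v\<close> the
  dual components of \<open>[v, e]\<close> are \<open>\<Sum>\<^sub>c B(S)\<^sub>h\<^sub>c e\<^sub>c\<close>, where \<open>B\<close> is a linear map of
  symmetric 3 \<times> 3 matrices depending on \<open>g\<close> whose inverse is explicit up to the factor \<open>det g\<close>;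
  this gives injectivity. A 2-form \<open>X\<close> satisfies \<open>X \<and> e = 0\<close> iff its dual components have no
  \<open>n\<close>-part and a symmetric matrix of \<open>e\<close>-coefficients, which is then \<open>B(S)\<close> for a unique
  symmetric \<open>S\<close>; this identifies the image. Finally \<open>W\<^sub>e\<^sup>(\<^sup>2\<^sup>,\<^sup>1\<^sup>)\<close> is onto by an
  explicit preimage read off from Cramer's rule for bivectors.\<close>

section \<open>Exterior algebra of the fibre\<close>

lemma ins_sign_empty [simp]: "ins_sign {} a = 1"
  by (simp add: ins_sign_def)

lemma ins_sign_insert [simp]:
  assumes "b \<notin> S" "finite S"
  shows "ins_sign (insert b S) a = (if a < b then -1 else 1) * ins_sign S a"
proof -
  have "{c \<in> insert b S. a < c} = (if a < b then insert b {c \<in> S. a < c} else {c \<in> S. a < c})"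
    by auto
  then show ?thesis
    using assms by (simp add: ins_sign_def)
qed

definition wedge_vec :: "(nat set \<Rightarrow> real) \<Rightarrow> (nat \<Rightarrow> real) \<Rightarrow> nat set \<Rightarrow> real" where
  "wedge_vec w x L = (\<Sum>i\<in>L. w (L - {i}) * x i * ins_sign (L - {i}) i)"

definition mv_one :: "nat set \<Rightarrow> real" where
  "mv_one L = (if L = {} then 1 else 0)"

definition bivec :: "(nat \<Rightarrow> real) \<Rightarrow> (nat \<Rightarrow> real) \<Rightarrow> nat set \<Rightarrow> real" where
  "bivec x y = wedge_vec (wedge_vec mv_one x) y"

definition vol_pairing :: "(nat set \<Rightarrow> real) \<Rightarrow> (nat \<Rightarrow> real) \<Rightarrow> (nat \<Rightarrow> real) \<Rightarrow> real" where
  "vol_pairing w x y = wedge_vec (wedge_vec w x) y {0,1,2,3}"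

definition det4 :: "(nat \<Rightarrow> real) \<Rightarrow> (nat \<Rightarrow> real) \<Rightarrow> (nat \<Rightarrow> real) \<Rightarrow> (nat \<Rightarrow> real) \<Rightarrow> real" where
  "det4 x y z w = vol_pairing (bivec x y) z w"

lemmas multivector_simps =
  wedge_vec_def mv_one_def bivec_def vol_pairing_def det4_def insert_Diff_if

lemma lessThan3_eq: "{..<3::nat} = {0,1,2}"
  by auto

lemma lessThan4_eq: "{..<4::nat} = {0,1,2,3}"
  by auto

lemma less3_cases: "(c::nat) < 3 \<Longrightarrow> c = 0 \<or> c = 1 \<or> c = 2"
  by auto

lemma less4_cases: "(m::nat) < 4 \<Longrightarrow> m = 0 \<or> m = 1 \<or> m = 2 \<or> m = 3"
  by auto

lemma subset_lessThan4_card2: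
  assumes "J \<subseteq> {..<4::nat}" "card J = 2"
  shows "J \<in> {{0,1},{0,2},{0,3},{1,2},{1,3},{2,3}}"
proof -
  obtain x y where xy: "J = {x,y}" "x \<noteq> y"
    using assms(2) by (auto simp: card_2_iff)
  then have "x \<in> {0,1,2,3}" "y \<in> {0,1,2,3}"
    using assms(1) by auto
  then show ?thesis
    using xy by (auto simp: doubleton_eq_iff)
qed

lemma subset_lessThan4_card2_obtain:
  assumes "L \<subseteq> {..<4::nat}" "card L = 2"
  obtains i j where "i < j" "j < 4" "L = {i,j}"
proof -
  obtain x y where xy: "L = {x,y}" "x \<noteq> y"
    using assms(2) by (auto simp: card_2_iff)
  then have "x < 4" "y < 4"
    using assms(1) by auto
  then show ?thesis
    using xy that by (metis insert_commute linorder_neqE_nat)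
qed

lemma bivec_pair:
  assumes "i < j"
  shows "bivec x y {i,j} = x i * y j - x j * y i"
  using assms by (simp add: multivector_simps)

lemma vol_pairing_swap: "vol_pairing w x y = - vol_pairing w y x"
  by (simp add: multivector_simps algebra_simps)

lemma vol_pairing_zero [simp]: "vol_pairing (\<lambda>_. 0) x y = 0"
  by (simp add: vol_pairing_def wedge_vec_def)

lemma det4_cramer:
  assumes "m < 4"
  shows "det4 x0 x1 x2 x3 * w m = det4 w x1 x2 x3 * x0 m + det4 x0 w x2 x3 * x1 m
     + det4 x0 x1 w x3 * x2 m + det4 x0 x1 x2 w * x3 m"
  using less4_cases[OF assms] by (elim disjE) (simp_all add: multivector_simps algebra_simps)

text \<open>Cramer's rule for bivectors in the basis \<open>x\<^sub>0, x\<^sub>1, x\<^sub>2, f\<close>: the coefficient of each basis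
  bivector is the pairing of \<open>om\<close> with the two complementary basis vectors.\<close>
lemma det4_cramer_bivec:
  assumes "J \<subseteq> {..<4}" "card J = 2"
  shows "det4 x0 x1 x2 f * om J =
     vol_pairing om x0 f * bivec x1 x2 J + vol_pairing om x1 f * bivec x2 x0 J
   + vol_pairing om x2 f * bivec x0 x1 J + vol_pairing om x1 x2 * bivec x0 f J
   + vol_pairing om x2 x0 * bivec x1 f J + vol_pairing om x0 x1 * bivec x2 f J"
  using subset_lessThan4_card2[OF assms]
  by (elim insertE emptyE) (simp_all add: multivector_simps algebra_simps)

definition mink :: "(nat \<Rightarrow> real) \<Rightarrow> (nat \<Rightarrow> real) \<Rightarrow> real" where
  "mink x y = (\<Sum>i<4. \<Sum>j<4. x i * eta i j * y j)"

lemma mink_commute: "mink x y = mink y x"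
  unfolding mink_def eta_def by (simp add: lessThan4_eq algebra_simps)

lemma act_pair:
  assumes "i < j"
  shows "act {i,j} k m = eta j k * (if m = i then 1 else 0) - eta i k * (if m = j then 1 else 0)"
  using assms by (simp add: act_def Let_def)

lemma card2_subsets_lessThan4:
  "{J. J \<subseteq> {..<4::nat} \<and> card J = 2} = {{0,1},{0,2},{0,3},{1,2},{1,3},{2,3}}"
proof (rule set_eqI, rule iffI)
  fix J
  assume "J \<in> {J. J \<subseteq> {..<4::nat} \<and> card J = 2}"
  then show "J \<in> {{0,1},{0,2},{0,3},{1,2},{1,3},{2,3}}"
    using subset_lessThan4_card2 by blast
qed auto

lemma sum_card2_subsets_lessThan4:
  "(\<Sum>J\<in>{J. J \<subseteq> {..<4::nat} \<and> card J = 2}. F J)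
     = F {0,1} + F {0,2} + F {0,3} + F {1,2} + F {1,3} + F {2,3}"
  unfolding card2_subsets_lessThan4 by (simp add: doubleton_eq_iff add.assoc)

definition bivec_act :: "(nat set \<Rightarrow> real) \<Rightarrow> (nat \<Rightarrow> real) \<Rightarrow> nat \<Rightarrow> real" where
  "bivec_act w x m = (\<Sum>J\<in>{J. J \<subseteq> {..<4} \<and> card J = 2}. \<Sum>k<4. w J * x k * act J k m)"

lemma bivec_act_bivec:
  assumes "m < 4"
  shows "bivec_act (bivec y z) x m = y m * mink z x - z m * mink y x"
  using less4_cases[OF assms] unfolding bivec_act_def sum_card2_subsets_lessThan4
  by (elim disjE) (simp_all add: act_pair bivec_pair mink_def eta_def lessThan4_eq algebra_simps)

lemma bivec_act_lincomb:
  assumes "\<And>J. J \<subseteq> {..<4} \<Longrightarrow> card J = 2 \<Longrightarrow> w J = (\<Sum>c\<in>C. s c * u c J)"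
  shows "bivec_act w x m = (\<Sum>c\<in>C. s c * bivec_act (u c) x m)"
proof -
  have "bivec_act w x m
      = (\<Sum>J\<in>{J. J \<subseteq> {..<4} \<and> card J = 2}. \<Sum>k<4. \<Sum>c\<in>C. s c * (u c J * x k * act J k m))"
    unfolding bivec_act_def using assms by (simp add: sum_distrib_right mult.assoc)
  also have "\<dots> = (\<Sum>c\<in>C. s c * bivec_act (u c) x m)"
    unfolding bivec_act_def sum_distrib_left by (simp add: sum.swap[where A = C])
  finally show ?thesis .
qed

section \<open>The frame \<open>e\<^sub>0, e\<^sub>1, e\<^sub>2, n\<close>\<close>

definition sym3 :: "(nat \<Rightarrow> nat \<Rightarrow> real) \<Rightarrow> bool" where
  "sym3 S \<longleftrightarrow> (\<forall>i<3. \<forall>j<3. S i j = S j i)"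

lemma sym3_iff: "sym3 S \<longleftrightarrow> S 1 0 = S 0 1 \<and> S 2 0 = S 0 2 \<and> S 2 1 = S 1 2"
proof
  assume S: "S 1 0 = S 0 1 \<and> S 2 0 = S 0 2 \<and> S 2 1 = S 1 2"
  show "sym3 S"
    unfolding sym3_def
  proof (intro allI impI)
    fix i j :: nat
    assume "i < 3" "j < 3"
    then have "i \<in> {0,1,2}" "j \<in> {0,1,2}"
      by auto
    then show "S i j = S j i"
      using S by auto
  qed
qed (simp add: sym3_def)

lemma pullback_metric_mink: "pullback_metric e a b = mink (e a) (e b)"
  by (simp add: pullback_metric_def mink_def)

lemma sym3_pullback_metric: "sym3 (pullback_metric e)"
  unfolding sym3_def pullback_metric_mink using mink_commute by simp

definition det3 :: "(nat \<Rightarrow> nat \<Rightarrow> real) \<Rightarrow> real" where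
  "det3 g = g 0 0 * g 1 1 * g 2 2 + g 0 1 * g 1 2 * g 2 0 + g 0 2 * g 1 0 * g 2 1
          - g 0 0 * g 1 2 * g 2 1 - g 0 1 * g 1 0 * g 2 2 - g 0 2 * g 1 1 * g 2 0"

lemma nondegenerate3_det3:
  assumes nd: "nondegenerate3 g"
  shows "det3 g \<noteq> 0"
proof -
  define M :: "real^3^3" where
    "M = vector [vector [g 0 0, g 1 0, g 2 0], vector [g 0 1, g 1 1, g 2 1], vector [g 0 2, g 1 2, g 2 2]]"
  have "x = 0" if Mx: "M *v x = 0" for x :: "real^3"
  proof -
    define u where "u a = (if a = 0 then x$1 else if a = 1 then x$2 else x$3)" for a :: nat
    have Mx1: "(M *v x)$1 = 0" "(M *v x)$2 = 0" "(M *v x)$3 = 0"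
      using Mx by simp_all
    have "(\<Sum>a<3. u a * g a b) = 0" if "b < 3" for b
      using less3_cases[OF that] Mx1
      by (elim disjE) (simp_all add: u_def M_def matrix_vector_mult_def sum_3 lessThan3_eq algebra_simps)
    then have "\<forall>a<3. u a = 0"
      using nd unfolding nondegenerate3_def by blast
    then have "u 0 = 0" "u 1 = 0" "u 2 = 0"
      by auto
    then have "x$1 = 0" "x$2 = 0" "x$3 = 0"
      by (simp_all add: u_def)
    then show "x = 0"
      by (simp add: vec_eq_iff forall_3)
  qed
  then have "invertible M"
    by (meson matrix_left_invertible_ker matrix_left_right_inverse invertible_def)
  then have "det M \<noteq> 0"
    by (rule invertible_det_nz[THEN iffD1])
  moreover have "det M = det3 g"
    by (simp add: det_3 M_def det3_def algebra_simps)
  ultimately show ?thesis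
    by simp
qed

text \<open>The sign factor is \<open>\<eta>\<close>: \<open>n\<close> is \<open>\<eta>\<close>-dual to \<open>w \<mapsto> det(e\<^sub>0, e\<^sub>1, e\<^sub>2, w)\<close>, which makes
  \<open>det(e\<^sub>0, e\<^sub>1, e\<^sub>2, n)\<close> a Gram determinant.\<close>
definition normal :: "(nat \<Rightarrow> nat \<Rightarrow> real) \<Rightarrow> nat \<Rightarrow> real" where
  "normal e i = (if i = 0 then -1 else 1) * det4 (e 0) (e 1) (e 2) (\<lambda>j. if j = i then 1 else 0)"

lemma det4_normal: "det4 (e 0) (e 1) (e 2) (normal e) = - det3 (pullback_metric e)"
  by (simp add: multivector_simps normal_def det3_def pullback_metric_def eta_def lessThan4_eq
      algebra_simps)

lemma nondeg_form_coeff_eq: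
  assumes "nondeg_form e"
    and "\<And>m. m < 4 \<Longrightarrow> (\<Sum>c<3. p c * e c m) = (\<Sum>c<3. q c * e c m)"
    and "c < 3"
  shows "p c = q c"
proof -
  have "\<forall>m<4. (\<Sum>c<3. (p c - q c) * e c m) = 0"
    using assms(2) by (simp add: left_diff_distrib sum_subtractf)
  then have "(\<lambda>c. p c - q c) c = 0"
    using assms(1)[unfolded nondeg_form_def, rule_format, of "\<lambda>c. p c - q c" c] assms(3)
    by blast
  then show ?thesis
    by simp
qed

lemma subset_lessThan3_card1:
  assumes "P \<subseteq> {..<3::nat}" "card P = 1"
  obtains a where "a < 3" "P = {a}"
  using assms by (auto simp: card_1_singleton_iff)

lemma subset_lessThan3_card2:
  assumes "P \<subseteq> {..<3::nat}" "card P = 2"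
  shows "P \<in> {{0,1},{0,2},{1,2}}"
proof -
  obtain x y where xy: "P = {x,y}" "x \<noteq> y"
    using assms(2) by (auto simp: card_2_iff)
  then have "x \<in> {0,1,2}" "y \<in> {0,1,2}"
    using assms(1) by auto
  then show ?thesis
    using xy by (auto simp: doubleton_eq_iff)
qed

lemma subset_lessThan3_card3:
  assumes "P \<subseteq> {..<3::nat}" "card P = 3"
  shows "P = {0,1,2}"
  using assms by (metis card_lessThan card_subset_eq finite_lessThan lessThan3_eq)

lemma subset_lessThan4_card1:
  assumes "K \<subseteq> {..<4::nat}" "card K = 1"
  obtains m where "m < 4" "K = {m}"
  using assms by (auto simp: card_1_singleton_iff)

lemma subset_lessThan4_card3:
  assumes "K \<subseteq> {..<4::nat}" "card K = 3"
  shows "K \<in> {{0,1,2},{0,1,3},{0,2,3},{1,2,3}}"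
proof -
  have "K \<noteq> {..<4}"
    using assms(2) by auto
  then obtain z where z: "z < 4" "z \<notin> K"
    using assms(1) by auto
  have "card ({..<4::nat} - {z}) = 3"
    using z by simp
  moreover have "K \<subseteq> {..<4} - {z}"
    using assms(1) z by auto
  ultimately have "K = {..<4} - {z}"
    using card_subset_eq assms(2) by (metis finite_Diff finite_lessThan)
  moreover note less4_cases[OF z(1)]
  ultimately show ?thesis
    by (auto simp: lessThan4_eq insert_Diff_if)
qed

lemma forms_eqI:
  assumes "X \<in> forms p k" "Y \<in> forms p k"
    and "\<And>P K. P \<subseteq> {..<3} \<Longrightarrow> card P = p \<Longrightarrow> K \<subseteq> {..<4} \<Longrightarrow> card K = k \<Longrightarrow> X P K = Y P K"
  shows "X = Y"
proof (intro ext)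
  fix P K
  show "X P K = Y P K"
  proof (cases "P \<subseteq> {..<3} \<and> card P = p \<and> K \<subseteq> {..<4} \<and> card K = k")
    case True
    then show ?thesis
      using assms(3) by blast
  next
    case False
    then have "X P K = 0" "Y P K = 0"
      using assms(1,2) unfolding forms_def by blast+
    then show ?thesis
      by simp
  qed
qed

lemma zero_forms [simp]: "(\<lambda>_ _. 0) \<in> forms p k"
  by (simp add: forms_def)

lemma W_forms:
  assumes "X \<in> forms p k"
  shows "W e p k X \<in> forms (Suc p) (Suc k)"
  unfolding forms_def
proof (intro CollectI allI impI)
  fix Q L
  assume nz: "W e p k X Q L \<noteq> 0"
  then have QL: "Q \<subseteq> {..<3}" "L \<subseteq> {..<4}"
    unfolding W_def wedge_e_def by (auto split: if_splits)
  then have "finite Q" "finite L"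
    by (auto intro: finite_subset)
  from nz QL obtain a i where ai: "a \<in> Q" "i \<in> L" "X (Q - {a}) (L - {i}) \<noteq> 0"
    unfolding W_def wedge_e_def by (auto elim!: sum.not_neutral_contains_not_neutral)
  then have "card (Q - {a}) = p" "card (L - {i}) = k"
    using assms unfolding forms_def by auto
  then have "card Q = Suc p" "card L = Suc k"
    using ai(1,2) \<open>finite Q\<close> \<open>finite L\<close> by (metis card_Suc_Diff1)+
  then show "Q \<subseteq> {..<3} \<and> card Q = Suc p \<and> L \<subseteq> {..<4} \<and> card L = Suc k"
    using QL by simp
qed

lemma W12_forms: "X \<in> forms 1 2 \<Longrightarrow> W e 1 2 X \<in> forms 2 3"
  using W_forms[of X 1 2 e] by (simp add: numeral_2_eq_2 numeral_3_eq_3)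

lemma W21_forms: "X \<in> forms 2 1 \<Longrightarrow> W e 2 1 X \<in> forms 3 2"
  using W_forms[of X 2 1 e] by (simp add: numeral_2_eq_2 numeral_3_eq_3)

lemmas W_simps = W_def wedge_e_def lessThan3_eq lessThan4_eq

definition next3 :: "nat \<Rightarrow> nat" where
  "next3 c = (c + 1) mod 3"

definition prev3 :: "nat \<Rightarrow> nat" where
  "prev3 c = (c + 2) mod 3"

text \<open>Stated with \<open>Suc 0\<close>, the simp normal form of \<open>1 :: nat\<close>.\<close>
lemma next3_simps [simp]: "next3 0 = Suc 0" "next3 (Suc 0) = 2" "next3 2 = 0"
  by (simp_all add: next3_def)

lemma prev3_simps [simp]: "prev3 0 = 2" "prev3 (Suc 0) = 0" "prev3 2 = Suc 0"
  by (simp_all add: prev3_def)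

text \<open>Components of a 2-form on \<open>dx\<^sup>1 \<and> dx\<^sup>2, dx\<^sup>2 \<and> dx\<^sup>0, dx\<^sup>0 \<and> dx\<^sup>1\<close>,
  that is, on \<open>dx\<^bsup>next3 h\<^esup> \<and> dx\<^bsup>prev3 h\<^esup>\<close>.\<close>
definition two_form_dual :: "coeffs \<Rightarrow> nat \<Rightarrow> nat \<Rightarrow> real" where
  "two_form_dual X h m = (if h = 0 then X {1,2} {m} else if h = 1 then - X {0,2} {m} else X {0,1} {m})"

definition two_form_of_dual :: "(nat \<Rightarrow> nat \<Rightarrow> real) \<Rightarrow> coeffs" where
  "two_form_of_dual Z P K =
     (if P \<subseteq> {..<3} \<and> card P = 2 \<and> K \<subseteq> {..<4} \<and> card K = 1 then
        (if 0 \<notin> P then Z 0 (the_elem K) else if 1 \<notin> P then - Z 1 (the_elem K) else Z 2 (the_elem K))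
      else 0)"

lemma two_form_of_dual_forms: "two_form_of_dual Z \<in> forms 2 1"
  unfolding forms_def two_form_of_dual_def by auto

lemma two_form_dual_of_dual:
  assumes "h < 3" "m < 4"
  shows "two_form_dual (two_form_of_dual Z) h m = Z h m"
  using less3_cases[OF assms(1)] assms(2)
  by (elim disjE) (simp_all add: two_form_dual_def two_form_of_dual_def)

lemma forms21_eq_dualI:
  assumes "X \<in> forms 2 1" "Y \<in> forms 2 1"
    and "\<And>h m. h < 3 \<Longrightarrow> m < 4 \<Longrightarrow> two_form_dual X h m = two_form_dual Y h m"
  shows "X = Y"
proof (rule forms_eqI[OF assms(1,2)])
  fix P K :: "nat set"
  assume P: "P \<subseteq> {..<3}" "card P = 2" and K: "K \<subseteq> {..<4}" "card K = 1"
  obtain m where m: "m < 4" "K = {m}"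
    using K by (rule subset_lessThan4_card1)
  have "P \<in> {{0,1},{0,2},{1,2}}"
    using P by (rule subset_lessThan3_card2)
  then show "X P K = Y P K"
    using assms(3)[of 0 m] assms(3)[of 1 m] assms(3)[of 2 m] m
    unfolding two_form_dual_def by auto
qed

text \<open>Because \<open>dx\<^bsup>next3 h\<^esup> \<and> dx\<^bsup>prev3 h\<^esup> \<and> dx\<^sup>h = dx\<^sup>0 \<and> dx\<^sup>1 \<and> dx\<^sup>2\<close> for every \<open>h\<close>.\<close>
lemma W21_dual:
  assumes "L \<subseteq> {..<4}" "card L = 2"
  shows "W e 2 1 X {0,1,2} L = (\<Sum>h<3. bivec (two_form_dual X h) (e h) L)"
  using subset_lessThan4_card2[OF assms]
  by (elim insertE emptyE)
     (simp_all add: W_simps two_form_dual_def multivector_simps algebra_simps)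

section \<open>The kernel of \<open>W\<^sub>e\<^sup>(\<^sup>1\<^sup>,\<^sup>2\<^sup>)\<close>\<close>

definition kernel_param :: "(nat \<Rightarrow> nat \<Rightarrow> real) \<Rightarrow> (nat \<Rightarrow> nat \<Rightarrow> real) \<Rightarrow> coeffs" where
  "kernel_param e S P K =
     (if P \<subseteq> {..<3} \<and> card P = 1 \<and> K \<subseteq> {..<4} \<and> card K = 2 then
        S (the_elem P) 0 * bivec (e 1) (e 2) K + S (the_elem P) 1 * bivec (e 2) (e 0) K
      + S (the_elem P) 2 * bivec (e 0) (e 1) K
      else 0)"

lemma kernel_param_forms: "kernel_param e S \<in> forms 1 2"
  unfolding forms_def kernel_param_def by auto

lemma kernel_param_apply:
  assumes "a < 3" "K \<subseteq> {..<4}" "card K = 2"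
  shows "kernel_param e S {a} K =
     S a 0 * bivec (e 1) (e 2) K + S a 1 * bivec (e 2) (e 0) K + S a 2 * bivec (e 0) (e 1) K"
  using assms by (simp add: kernel_param_def)

lemma kernel_param_cong:
  assumes "\<And>a c. a < 3 \<Longrightarrow> c < 3 \<Longrightarrow> S a c = S' a c"
  shows "kernel_param e S = kernel_param e S'"
proof (rule forms_eqI[OF kernel_param_forms kernel_param_forms])
  fix P K :: "nat set"
  assume P: "P \<subseteq> {..<3}" "card P = 1" and K: "K \<subseteq> {..<4}" "card K = 2"
  obtain a where "a < 3" "P = {a}"
    using P by (rule subset_lessThan3_card1)
  then show "kernel_param e S P K = kernel_param e S' P K"
    using kernel_param_apply[OF _ K] assms by simp
qed

lemma W12_kernel_param:
  assumes "sym3 S"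
  shows "W e 1 2 (kernel_param e S) = (\<lambda>_ _. 0)"
proof (rule forms_eqI[OF W12_forms[OF kernel_param_forms] zero_forms])
  fix Q L :: "nat set"
  assume "Q \<subseteq> {..<3}" "card Q = 2" "L \<subseteq> {..<4}" "card L = 3"
  then have "Q \<in> {{0,1},{0,2},{1,2}}" "L \<in> {{0,1,2},{0,1,3},{0,2,3},{1,2,3}}"
    using subset_lessThan3_card2 subset_lessThan4_card3 by blast+
  then show "W e 1 2 (kernel_param e S) Q L = 0"
    using assms unfolding sym3_iff
    by (elim insertE emptyE) (simp_all add: W_simps kernel_param_def multivector_simps algebra_simps)
qed

lemma vol_pairing_W12:
  assumes "a < b" "b < 3"
  shows "vol_pairing (v {a}) (e b) x - vol_pairing (v {b}) (e a) x
       = wedge_vec (W e 1 2 v {a,b}) x {0,1,2,3}"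
proof -
  have "(a, b) \<in> {(0,1),(0,2),(1,2)}"
    using assms by auto
  then show ?thesis
    by (elim insertE emptyE) (simp_all add: multivector_simps W_simps algebra_simps)
qed

lemma kernel_W12_vol_pairing_sym:
  assumes "W e 1 2 v = (\<lambda>_ _. 0)" "a < 3" "b < 3"
  shows "vol_pairing (v {a}) (e b) x = vol_pairing (v {b}) (e a) x"
proof -
  have "vol_pairing (v {a}) (e b) x = vol_pairing (v {b}) (e a) x" if "a < b" "b < 3" for a b
    using vol_pairing_W12[OF that, of v e x] assms(1) by (simp add: wedge_vec_def)
  then show ?thesis
    using assms(2,3) by (metis linorder_neqE_nat)
qed

text \<open>A coefficient symmetric in its first two slots and antisymmetric in its last two vanishes.\<close>
lemma kernel_W12_vol_pairing_zero:
  assumes k: "W e 1 2 v = (\<lambda>_ _. 0)" and "a < 3" "x < 3" "y < 3"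
  shows "vol_pairing (v {a}) (e x) (e y) = 0"
proof -
  note sym = kernel_W12_vol_pairing_sym[OF k]
  have "vol_pairing (v {a}) (e x) (e y) = vol_pairing (v {x}) (e a) (e y)"
    using sym assms by blast
  also have "\<dots> = - vol_pairing (v {x}) (e y) (e a)"
    by (rule vol_pairing_swap)
  also have "\<dots> = - vol_pairing (v {y}) (e x) (e a)"
    using sym assms by simp
  also have "\<dots> = vol_pairing (v {y}) (e a) (e x)"
    using vol_pairing_swap[of "v {y}" "e x" "e a"] by simp
  also have "\<dots> = vol_pairing (v {a}) (e y) (e x)"
    using sym assms by simp
  also have "\<dots> = - vol_pairing (v {a}) (e x) (e y)"
    by (rule vol_pairing_swap)
  finally show ?thesis
    by simp
qed

lemma kernel_W12_eq_kernel_param: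
  assumes v: "v \<in> forms 1 2" "W e 1 2 v = (\<lambda>_ _. 0)"
    and D: "det4 (e 0) (e 1) (e 2) f \<noteq> 0"
  shows "v = kernel_param e (\<lambda>a c. vol_pairing (v {a}) (e c) f / det4 (e 0) (e 1) (e 2) f)"
proof (rule forms_eqI[OF v(1) kernel_param_forms])
  fix P K :: "nat set"
  assume P: "P \<subseteq> {..<3}" "card P = 1" and K: "K \<subseteq> {..<4}" "card K = 2"
  obtain a where a: "a < 3" "P = {a}"
    using P by (rule subset_lessThan3_card1)
  have "vol_pairing (v {a}) (e 1) (e 2) = 0" "vol_pairing (v {a}) (e 2) (e 0) = 0"
       "vol_pairing (v {a}) (e 0) (e 1) = 0"
    using kernel_W12_vol_pairing_zero[OF v(2)] a by auto
  then show "v P K = kernel_param e (\<lambda>a c. vol_pairing (v {a}) (e c) f / det4 (e 0) (e 1) (e 2) f) P K"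
    using det4_cramer_bivec[OF K, of "e 0" "e 1" "e 2" f "v {a}"] D
    unfolding a(2) kernel_param_apply[OF a(1) K] by (simp add: field_simps)
qed

lemma kernel_W12_eq:
  assumes "det4 (e 0) (e 1) (e 2) f \<noteq> 0"
  shows "{X \<in> forms 1 2. W e 1 2 X = (\<lambda>_ _. 0)} = kernel_param e ` {S. sym3 S}"
proof
  show "{X \<in> forms 1 2. W e 1 2 X = (\<lambda>_ _. 0)} \<subseteq> kernel_param e ` {S. sym3 S}"
  proof clarify
    fix v
    assume v: "v \<in> forms 1 2" "W e 1 2 v = (\<lambda>_ _. 0)"
    have "sym3 (\<lambda>a c. vol_pairing (v {a}) (e c) f / det4 (e 0) (e 1) (e 2) f)"
      unfolding sym3_def using kernel_W12_vol_pairing_sym[OF v(2)] by simp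
    then show "v \<in> kernel_param e ` {S. sym3 S}"
      using kernel_W12_eq_kernel_param[OF v assms] by blast
  qed
qed (blast intro: kernel_param_forms W12_kernel_param)

section \<open>Surjectivity of \<open>W\<^sub>e\<^sup>(\<^sup>2\<^sup>,\<^sup>1\<^sup>)\<close>\<close>

text \<open>Read off from \<open>det4_cramer_bivec\<close> applied to \<open>Y\<^sub>0\<^sub>1\<^sub>2\<close>.\<close>
definition W21_preimage :: "(nat \<Rightarrow> nat \<Rightarrow> real) \<Rightarrow> (nat \<Rightarrow> real) \<Rightarrow> coeffs \<Rightarrow> coeffs" where
  "W21_preimage e f Y = two_form_of_dual (\<lambda>h m.
     (vol_pairing (Y {0,1,2}) (e (next3 h)) f * e (prev3 h) m
      - vol_pairing (Y {0,1,2}) (e (next3 h)) (e (prev3 h)) * f m) / det4 (e 0) (e 1) (e 2) f)"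

lemma W21_W21_preimage:
  assumes Y: "Y \<in> forms 3 2" and D: "det4 (e 0) (e 1) (e 2) f \<noteq> 0"
  shows "W e 2 1 (W21_preimage e f Y) = Y"
proof (rule forms_eqI[OF _ Y])
  show "W e 2 1 (W21_preimage e f Y) \<in> forms 3 2"
    unfolding W21_preimage_def by (rule W21_forms[OF two_form_of_dual_forms])
  fix P L :: "nat set"
  assume P: "P \<subseteq> {..<3}" "card P = 3" and L: "L \<subseteq> {..<4}" "card L = 2"
  obtain i j where ij: "i < j" "j < 4" "L = {i,j}"
    using L by (rule subset_lessThan4_card2_obtain)
  then have "i < 4"
    by simp
  let ?Y = "Y {0,1,2}" and ?D = "det4 (e 0) (e 1) (e 2) f"
  have "?D * W e 2 1 (W21_preimage e f Y) {0,1,2} L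
      = ?D * (\<Sum>h<3. bivec (two_form_dual (W21_preimage e f Y) h) (e h) L)"
    using W21_dual[OF L] by simp
  also have "\<dots> = ?D * ?Y L"
    unfolding det4_cramer_bivec[OF L] unfolding ij(3)
    using ij \<open>i < 4\<close> D
    by (simp add: bivec_pair two_form_dual_of_dual W21_preimage_def lessThan3_eq field_simps)
  finally show "W e 2 1 (W21_preimage e f Y) P L = Y P L"
    using subset_lessThan3_card3[OF P] D by simp
qed

lemma W21_image:
  assumes "det4 (e 0) (e 1) (e 2) f \<noteq> 0"
  shows "W e 2 1 ` forms 2 1 = forms 3 2"
proof
  show "W e 2 1 ` forms 2 1 \<subseteq> forms 3 2"
    using W21_forms by blast
  show "forms 3 2 \<subseteq> W e 2 1 ` forms 2 1"
  proof
    fix Y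
    assume "Y \<in> forms 3 2"
    then have "Y = W e 2 1 (W21_preimage e f Y)"
      using W21_W21_preimage[OF _ assms] by simp
    moreover have "W21_preimage e f Y \<in> forms 2 1"
      unfolding W21_preimage_def by (rule two_form_of_dual_forms)
    ultimately show "Y \<in> W e 2 1 ` forms 2 1"
      by blast
  qed
qed

section \<open>The kernel of \<open>W\<^sub>e\<^sup>(\<^sup>2\<^sup>,\<^sup>1\<^sup>)\<close>\<close>

definition cramer_coord :: "(nat \<Rightarrow> nat \<Rightarrow> real) \<Rightarrow> (nat \<Rightarrow> real) \<Rightarrow> (nat \<Rightarrow> real) \<Rightarrow> nat \<Rightarrow> real" where
  "cramer_coord e f w c =
     (if c = 0 then det4 w (e 1) (e 2) f else if c = 1 then det4 (e 0) w (e 2) f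
      else if c = 2 then det4 (e 0) (e 1) w f else det4 (e 0) (e 1) (e 2) w)"

lemma det4_cramer_coord:
  assumes "m < 4"
  shows "det4 (e 0) (e 1) (e 2) f * w m
       = (\<Sum>c<3. cramer_coord e f w c * e c m) + cramer_coord e f w 3 * f m"
  using det4_cramer[OF assms, of "e 0" "e 1" "e 2" f w]
  by (simp add: cramer_coord_def lessThan3_eq)

lemma vol_pairing_W21_normal:
  assumes "h < 3"
  shows "vol_pairing (W e 2 1 X {0,1,2}) (e (next3 h)) (e (prev3 h))
       = - cramer_coord e f (two_form_dual X h) 3"
  using less3_cases[OF assms]
  by (elim disjE)
     (simp_all add: multivector_simps W_simps cramer_coord_def two_form_dual_def algebra_simps)

lemma vol_pairing_W21_tangent:
  assumes "c < 3"
  shows "vol_pairing (W e 2 1 X {0,1,2}) (e c) f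
       = cramer_coord e f (two_form_dual X (prev3 c)) (next3 c)
         - cramer_coord e f (two_form_dual X (next3 c)) (prev3 c)"
  using less3_cases[OF assms]
  by (elim disjE)
     (simp_all add: multivector_simps W_simps cramer_coord_def two_form_dual_def algebra_simps)

lemma kernel_W21_cramer_coord:
  assumes "W e 2 1 X = (\<lambda>_ _. 0)"
  shows "\<And>h. h < 3 \<Longrightarrow> cramer_coord e f (two_form_dual X h) 3 = 0"
    and "sym3 (\<lambda>h c. cramer_coord e f (two_form_dual X h) c)"
proof -
  have W0: "vol_pairing (W e 2 1 X {0,1,2}) x y = 0" for x y
    using assms by simp
  show "cramer_coord e f (two_form_dual X h) 3 = 0" if "h < 3" for h
    using vol_pairing_W21_normal[OF that, of e X f] W0 by simp
  show "sym3 (\<lambda>h c. cramer_coord e f (two_form_dual X h) c)"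
    unfolding sym3_iff
    using vol_pairing_W21_tangent[of 0 e X f] vol_pairing_W21_tangent[of 1 e X f]
      vol_pairing_W21_tangent[of 2 e X f] W0 by simp
qed

section \<open>The bracket on the kernel of \<open>W\<^sub>e\<^sup>(\<^sup>1\<^sup>,\<^sup>2\<^sup>)\<close>\<close>

lemma bracket_forms: "bracket v e \<in> forms 2 1"
  unfolding forms_def bracket_def by (auto split: if_splits)

lemma bracket_pair:
  assumes "a < b" "b < 3" "m < 4"
  shows "bracket v e {a,b} {m} = bivec_act (v {a}) (e b) m - bivec_act (v {b}) (e a) m"
proof -
  have "a \<noteq> b" "\<not> b < a"
    using assms(1) by auto
  then show ?thesis
    using assms by (simp add: bracket_def bivec_act_def insert_Diff_if sum_negf)
qed

lemma two_form_dual_bracket: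
  assumes "h < 3" "m < 4"
  shows "two_form_dual (bracket v e) h m
       = bivec_act (v {next3 h}) (e (prev3 h)) m - bivec_act (v {prev3 h}) (e (next3 h)) m"
  using less3_cases[OF assms(1)] assms(2)
  by (elim disjE) (simp_all add: two_form_dual_def bracket_pair)

lemma bivec_act_kernel_param:
  assumes "a < 3" "m < 4"
  shows "bivec_act (kernel_param e S {a}) x m
       = (\<Sum>c<3. S a c * (e (next3 c) m * mink (e (prev3 c)) x - e (prev3 c) m * mink (e (next3 c)) x))"
proof -
  have "bivec_act (kernel_param e S {a}) x m = (\<Sum>c<3. S a c * bivec_act (bivec (e (next3 c)) (e (prev3 c))) x m)"
    by (rule bivec_act_lincomb) (simp add: kernel_param_apply[OF assms(1)] lessThan3_eq)
  then show ?thesis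
    using bivec_act_bivec[OF assms(2)] by simp
qed

text \<open>Coefficient of \<open>e\<^sub>c\<close> in \<open>v\<^bsub>next3 h\<^esub> \<cdot> e\<^bsub>prev3 h\<^esub> - v\<^bsub>prev3 h\<^esub> \<cdot> e\<^bsub>next3 h\<^esub>\<close> for
  \<open>v = kernel_param e S\<close>, by \<open>bivec_act_bivec\<close>.\<close>
definition bracket_dual :: "(nat \<Rightarrow> nat \<Rightarrow> real) \<Rightarrow> (nat \<Rightarrow> nat \<Rightarrow> real) \<Rightarrow> nat \<Rightarrow> nat \<Rightarrow> real" where
  "bracket_dual g S h c =
     S (next3 h) (prev3 c) * g (next3 c) (prev3 h) - S (prev3 h) (prev3 c) * g (next3 c) (next3 h)
   - S (next3 h) (next3 c) * g (prev3 c) (prev3 h) + S (prev3 h) (next3 c) * g (prev3 c) (next3 h)"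

lemma two_form_dual_bracket_kernel_param:
  assumes "h < 3" "m < 4"
  shows "two_form_dual (bracket (kernel_param e S) e) h m
       = (\<Sum>c<3. bracket_dual (pullback_metric e) S h c * e c m)"
  using less3_cases[OF assms(1)] assms(2)
  by (elim disjE)
     (simp_all add: two_form_dual_bracket bivec_act_kernel_param bracket_dual_def pullback_metric_mink
       lessThan3_eq mink_commute algebra_simps)

lemma sym3_bracket_dual:
  assumes "sym3 g" "sym3 S"
  shows "sym3 (bracket_dual g S)"
  using assms unfolding sym3_iff bracket_dual_def by (simp add: algebra_simps)

lemma sym3_sum_antisym_zero:
  assumes "sym3 B"
  shows "(\<Sum>h<3. \<Sum>c<3. B h c * (x c * y h - x h * y c)) = 0"
  using assms unfolding sym3_iff by (simp add: lessThan3_eq algebra_simps)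

lemma W21_bracket_kernel_param:
  assumes "sym3 S"
  shows "W e 2 1 (bracket (kernel_param e S) e) = (\<lambda>_ _. 0)"
proof (rule forms_eqI[OF W21_forms[OF bracket_forms] zero_forms])
  fix P L :: "nat set"
  assume P: "P \<subseteq> {..<3}" "card P = 3" and L: "L \<subseteq> {..<4}" "card L = 2"
  obtain i j where ij: "i < j" "j < 4" "L = {i,j}"
    using L by (rule subset_lessThan4_card2_obtain)
  then have "i < 4"
    by simp
  let ?B = "bracket_dual (pullback_metric e) S"
  have "W e 2 1 (bracket (kernel_param e S) e) {0,1,2} L
      = (\<Sum>h<3. \<Sum>c<3. ?B h c * (e c i * e h j - e h i * e c j))"
    using W21_dual[OF L, of e "bracket (kernel_param e S) e"] ij \<open>i < 4\<close>
    by (simp add: bivec_pair two_form_dual_bracket_kernel_param lessThan3_eq algebra_simps)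
  also have "\<dots> = 0"
    by (rule sym3_sum_antisym_zero[OF sym3_bracket_dual[OF sym3_pullback_metric assms]])
  finally show "W e 2 1 (bracket (kernel_param e S) e) P L = 0"
    using subset_lessThan3_card3[OF P] by simp
qed

text \<open>For \<open>g = 1\<close> one has \<open>bracket_dual g S = S - (tr S) 1\<close>, inverted by
  \<open>Z \<mapsto> Z - (tr Z / 2) 1\<close>; the general formula is the covariant version of this inverse,
  scaled by \<open>det g\<close>.\<close>
definition bracket_dual_adj :: "(nat \<Rightarrow> nat \<Rightarrow> real) \<Rightarrow> (nat \<Rightarrow> nat \<Rightarrow> real) \<Rightarrow> nat \<Rightarrow> nat \<Rightarrow> real" where
  "bracket_dual_adj g Z i j =
     (\<Sum>p<3. \<Sum>q<3. g i p * Z p q * g q j) - (\<Sum>p<3. \<Sum>q<3. Z p q * g q p) / 2 * g i j"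

lemma bracket_dual_adj_bracket_dual:
  assumes "sym3 g" "sym3 S" "i < 3" "j < 3"
  shows "bracket_dual_adj g (bracket_dual g S) i j = det3 g * S i j"
  using less3_cases[OF assms(3)] less3_cases[OF assms(4)] assms(1,2) unfolding sym3_iff
  by (elim disjE) (simp_all add: bracket_dual_adj_def bracket_dual_def det3_def lessThan3_eq field_simps)

lemma bracket_dual_bracket_dual_adj:
  assumes "sym3 g" "sym3 Z" "h < 3" "c < 3"
  shows "bracket_dual g (bracket_dual_adj g Z) h c = det3 g * Z h c"
  using less3_cases[OF assms(3)] less3_cases[OF assms(4)] assms(1,2) unfolding sym3_iff
  by (elim disjE) (simp_all add: bracket_dual_adj_def bracket_dual_def det3_def lessThan3_eq field_simps)

lemma sym3_bracket_dual_adj: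
  assumes "sym3 g" "sym3 Z"
  shows "sym3 (bracket_dual_adj g Z)"
  using assms unfolding sym3_iff by (simp add: bracket_dual_adj_def lessThan3_eq field_simps)

lemma bracket_kernel_param_inj:
  assumes nd: "nondeg_form e" and dg: "det3 (pullback_metric e) \<noteq> 0"
    and S: "sym3 S" "sym3 S'"
    and eq: "bracket (kernel_param e S) e = bracket (kernel_param e S') e"
  shows "kernel_param e S = kernel_param e S'"
proof (rule kernel_param_cong)
  let ?g = "pullback_metric e"
  have dual: "bracket_dual ?g S h c = bracket_dual ?g S' h c" if "h < 3" "c < 3" for h c
  proof (rule nondeg_form_coeff_eq[OF nd _ that(2)])
    fix m :: nat
    assume m: "m < 4"
    show "(\<Sum>c<3. bracket_dual ?g S h c * e c m) = (\<Sum>c<3. bracket_dual ?g S' h c * e c m)"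
      using two_form_dual_bracket_kernel_param[OF that(1) m, of e S]
        two_form_dual_bracket_kernel_param[OF that(1) m, of e S'] eq by simp
  qed
  fix i j :: nat
  assume ij: "i < 3" "j < 3"
  have "det3 ?g * S i j = bracket_dual_adj ?g (bracket_dual ?g S) i j"
    using bracket_dual_adj_bracket_dual[OF sym3_pullback_metric S(1) ij] by simp
  also have "\<dots> = bracket_dual_adj ?g (bracket_dual ?g S') i j"
    using dual by (simp add: bracket_dual_adj_def lessThan3_eq)
  also have "\<dots> = det3 ?g * S' i j"
    using bracket_dual_adj_bracket_dual[OF sym3_pullback_metric S(2) ij] by simp
  finally show "S i j = S' i j"
    using dg by simp
qed

lemma bracket_image_kernel_W12:
  assumes D: "det4 (e 0) (e 1) (e 2) f \<noteq> 0" and dg: "det3 (pullback_metric e) \<noteq> 0"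
  shows "(\<lambda>v. bracket v e) ` kernel_param e ` {S. sym3 S} = {X \<in> forms 2 1. W e 2 1 X = (\<lambda>_ _. 0)}"
proof
  show "(\<lambda>v. bracket v e) ` kernel_param e ` {S. sym3 S} \<subseteq> {X \<in> forms 2 1. W e 2 1 X = (\<lambda>_ _. 0)}"
    using bracket_forms W21_bracket_kernel_param by auto
  show "{X \<in> forms 2 1. W e 2 1 X = (\<lambda>_ _. 0)} \<subseteq> (\<lambda>v. bracket v e) ` kernel_param e ` {S. sym3 S}"
  proof clarify
    fix X
    assume X: "X \<in> forms 2 1" "W e 2 1 X = (\<lambda>_ _. 0)"
    let ?g = "pullback_metric e" and ?D = "det4 (e 0) (e 1) (e 2) f"
    define \<Gamma> where "\<Gamma> h c = cramer_coord e f (two_form_dual X h) c" for h c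
    define S where "S i j = bracket_dual_adj ?g \<Gamma> i j / (?D * det3 ?g)" for i j
    have \<Gamma>: "sym3 \<Gamma>"
      using kernel_W21_cramer_coord(2)[OF X(2)] unfolding \<Gamma>_def .
    have S: "sym3 S"
      using sym3_bracket_dual_adj[OF sym3_pullback_metric \<Gamma>] unfolding S_def sym3_def by simp
    have B: "bracket_dual ?g S h c = \<Gamma> h c / ?D" if "h < 3" "c < 3" for h c
    proof -
      have "bracket_dual ?g S h c = bracket_dual ?g (bracket_dual_adj ?g \<Gamma>) h c / (?D * det3 ?g)"
        unfolding S_def bracket_dual_def by (simp add: diff_divide_distrib add_divide_distrib)
      then show ?thesis
        using bracket_dual_bracket_dual_adj[OF sym3_pullback_metric \<Gamma> that] dg by simp
    qed
    have "bracket (kernel_param e S) e = X"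
    proof (rule forms21_eq_dualI[OF bracket_forms X(1)])
      fix h m :: nat
      assume hm: "h < 3" "m < 4"
      have cramer: "?D * two_form_dual X h m = (\<Sum>c<3. \<Gamma> h c * e c m)"
        using det4_cramer_coord[OF hm(2), of e f "two_form_dual X h"]
          kernel_W21_cramer_coord(1)[OF X(2) hm(1)]
        unfolding \<Gamma>_def by simp
      have "two_form_dual (bracket (kernel_param e S) e) h m = (\<Sum>c<3. \<Gamma> h c / ?D * e c m)"
        using B[OF hm(1)] by (simp add: two_form_dual_bracket_kernel_param[OF hm])
      also have "\<dots> = (\<Sum>c<3. \<Gamma> h c * e c m) / ?D"
        by (simp add: sum_divide_distrib)
      also have "\<dots> = two_form_dual X h m"
        using cramer D by (simp add: divide_eq_eq mult.commute)
      finally show "two_form_dual (bracket (kernel_param e S) e) h m = two_form_dual X h m" .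
    qed
    then show "X \<in> (\<lambda>v. bracket v e) ` kernel_param e ` {S. sym3 S}"
      using S by blast
  qed
qed

theorem corollary4p10:
  fixes e :: "nat \<Rightarrow> nat \<Rightarrow> real"
  assumes "nondeg_form e"
    and "nondegenerate3 (pullback_metric e)"
  shows "inj_on (\<lambda>v. bracket v e) {X \<in> forms 1 2. W e 1 2 X = (\<lambda>_ _. 0)}
       \<and> (\<lambda>v. bracket v e) ` {X \<in> forms 1 2. W e 1 2 X = (\<lambda>_ _. 0)}
            = {X \<in> forms 2 1. W e 2 1 X = (\<lambda>_ _. 0)}
       \<and> W e 2 1 ` forms 2 1 = forms 3 2"
proof -
  have dg: "det3 (pullback_metric e) \<noteq> 0"
    using assms(2) by (rule nondegenerate3_det3)
  then have D: "det4 (e 0) (e 1) (e 2) (normal e) \<noteq> 0"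
    using det4_normal[of e] by simp
  have kernel: "{X \<in> forms 1 2. W e 1 2 X = (\<lambda>_ _. 0)} = kernel_param e ` {S. sym3 S}"
    by (rule kernel_W12_eq[OF D])
  have "inj_on (\<lambda>v. bracket v e) (kernel_param e ` {S. sym3 S})"
    using bracket_kernel_param_inj[OF assms(1) dg] by (auto intro!: inj_onI)
  moreover have "(\<lambda>v. bracket v e) ` kernel_param e ` {S. sym3 S}
      = {X \<in> forms 2 1. W e 2 1 X = (\<lambda>_ _. 0)}"
    by (rule bracket_image_kernel_W12[OF D dg])
  moreover have "W e 2 1 ` forms 2 1 = forms 3 2"
    by (rule W21_image[OF D])
  ultimately show ?thesis
    unfolding kernel by blast
qed

end
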